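(* Fix integers $q\ge2$ and $d\ge0$, and define $p:=\frac{q-1}q$ and $\sigma^2:=p(1-p)$ with $\sigma>0$. Then, for every compact set $K\subset\mathbb R$, $$\frac{K_d^{(q)}\big(\lfloor Np+\sigma\sqrt N\,x\rfloor;N\big)}{\sqrt{(q-1)^d\binom Nd}}\longrightarrow\frac{(-1)^d}{\sqrt{d!}}\,\mathrm{He}_d(x)$$ uniformly for $x\in K$, as $N\to\infty$.
   Context: For $d,h\in\{0,\ldots,N\}$ the $q$-ary Krawtchouk polynomial is $K_d^{(q)}(h;N)=\sum_{j=0}^{\min(d,h)}(-1)^j(q-1)^{d-j}\binom hj\binom{N-h}{d-j}$, with $K_0^{(q)}(h;N)=1$. For a given compact set $K$, $N$ is taken large enough that $N\ge d$ and $\lfloor Np+\sigma\sqrt N\,x\rfloor\in\{0,\ldots,N\}$ for all $x\in K$. $\mathrm{He}_d$ is the $d$-th probabilists' Hermite polynomial, given by $e^{xt-t^2/2}=\sum_{m\ge0}\mathrm{He}_m(x)t^m/m!$. *)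

theory Defs
  imports "HOL-Analysis.Analysis"
begin

text \<open>
  Meaningful for \<open>d \<le> N\<close> and \<open>h \<le> N\<close>; the subtraction \<open>N - h\<close> is on naturals and does not
  truncate there.
\<close>
definition krawtchouk :: "nat \<Rightarrow> nat \<Rightarrow> nat \<Rightarrow> nat \<Rightarrow> real" where
  "krawtchouk q d h N =
     (\<Sum>j = 0..min d h. (-1) ^ j * (real q - 1) ^ (d - j) * real (h choose j) * real ((N - h) choose (d - j)))"

text \<open>
  \<open>He m x / fact m\<close> is the coefficient of \<open>t ^ m\<close> in the formal power series
  \<open>exp (x * t - t\<^sup>2 / 2)\<close>; the lemma \<open>He_generating_function\<close> below is the analytic
  form of the generating function.
\<close>
definition He :: "nat \<Rightarrow> real \<Rightarrow> real" where
  "He m x = fact m * fps_nth (fps_exp 1 oo (fps_const x * fps_X - fps_const (1 / 2) * fps_X ^ 2)) m"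

text \<open>The power series of \<open>exp (- t\<^sup>2 / 2)\<close>.\<close>
definition gauss_fps :: "real fps" where
  "gauss_fps = Abs_fps (\<lambda>n. if even n then (- 1 / 2) ^ (n div 2) / fact (n div 2) else 0)"

lemma gauss_fps_sums: "(\<lambda>n. fps_nth gauss_fps n * t ^ n) sums exp (- t\<^sup>2 / 2)"
proof -
  have "(\<lambda>k. (- t\<^sup>2 / 2) ^ k /\<^sub>R fact k) sums exp (- t\<^sup>2 / 2)"
    by (rule exp_converges)
  also have "(\<lambda>k. (- t\<^sup>2 / 2) ^ k /\<^sub>R fact k) = (\<lambda>k. fps_nth gauss_fps (2 * k) * t ^ (2 * k))"
  proof
    fix k
    have "(- t\<^sup>2 / 2) ^ k = (- 1 / 2) ^ k * (t\<^sup>2) ^ k"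
      using power_mult_distrib[of "- 1 / 2" "t\<^sup>2" k] by simp
    moreover have "(t\<^sup>2) ^ k = t ^ (2 * k)"
      by (rule power_mult[symmetric])
    moreover have "fps_nth gauss_fps (2 * k) = (- 1 / 2) ^ k / fact k"
      by (simp add: gauss_fps_def)
    ultimately show "(- t\<^sup>2 / 2) ^ k /\<^sub>R fact k = fps_nth gauss_fps (2 * k) * t ^ (2 * k)"
      by (simp only: real_scaleR_def divide_inverse mult_ac)
  qed
  finally have "(\<lambda>k. fps_nth gauss_fps (2 * k) * t ^ (2 * k)) sums exp (- t\<^sup>2 / 2)" .
  moreover have "fps_nth gauss_fps n * t ^ n = 0" if "n \<notin> range ((*) 2)" for n
    using that by (auto simp: gauss_fps_def elim!: evenE)
  ultimately show ?thesis
    using sums_mono_reindex[of "(*) 2" "\<lambda>n. fps_nth gauss_fps n * t ^ n"]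
    by (simp add: strict_mono_def)
qed

lemma fps_conv_radius_gauss_fps: "fps_conv_radius gauss_fps = \<infinity>"
  unfolding fps_conv_radius_def
proof (rule conv_radius_inftyI')
  fix r :: real
  assume "r > 0"
  then show "\<exists>z::real. norm z = r \<and> summable (\<lambda>n. fps_nth gauss_fps n * z ^ n)"
    using gauss_fps_sums[of r] by (intro exI[of _ r]) (auto simp: sums_iff)
qed

lemma fps_deriv_gauss_fps: "fps_deriv gauss_fps = - fps_X * gauss_fps"
proof (rule fps_ext)
  fix n
  show "fps_nth (fps_deriv gauss_fps) n = fps_nth (- fps_X * gauss_fps) n"
  proof (cases "odd n")
    case True
    then obtain k where "n = 2 * k + 1" by (elim oddE)
    moreover have "real (2 * k + 2) * ((- 1 / 2) ^ Suc k / fact (Suc k)) = - ((- 1 / 2) ^ k / fact k)"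
      by (simp add: divide_simps)
    ultimately show ?thesis
      by (simp add: gauss_fps_def)
  next
    case False
    then show ?thesis
      by (cases n) (auto simp: gauss_fps_def)
  qed
qed

lemma fps_linear_ode_unique:
  fixes F G :: "real fps"
  assumes "fps_deriv F = A * F" "fps_deriv G = A * G" "fps_nth F 0 = fps_nth G 0"
  shows "F = G"
proof (rule fps_ext)
  fix n
  show "fps_nth F n = fps_nth G n"
  proof (induction n rule: less_induct)
    case (less n)
    show ?case
    proof (cases n)
      case (Suc m)
      have "fps_nth (A * F) m = fps_nth (A * G) m"
        unfolding fps_mult_nth using less Suc by (intro sum.cong) auto
      then have "fps_nth (fps_deriv F) m = fps_nth (fps_deriv G) m"
        using assms by simp
      then show ?thesis using Suc by simp
    qed (use assms in simp)
  qed
qed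

lemma He_fps:
  "fps_exp 1 oo (fps_const x * fps_X - fps_const (1 / 2) * fps_X ^ 2) = fps_exp x * gauss_fps"
proof (rule fps_linear_ode_unique)
  let ?A = "fps_const x * fps_X - fps_const (1 / 2) * fps_X ^ 2 :: real fps"
  have "fps_deriv ?A = fps_const x - fps_X"
    by (auto simp: fps_eq_iff)
  then show "fps_deriv (fps_exp 1 oo ?A) = (fps_const x - fps_X) * (fps_exp 1 oo ?A)"
    by (simp add: fps_compose_deriv mult.commute)
  show "fps_deriv (fps_exp x * gauss_fps) = (fps_const x - fps_X) * (fps_exp x * gauss_fps)"
    by (simp add: fps_deriv_gauss_fps algebra_simps)
  show "fps_nth (fps_exp 1 oo ?A) 0 = fps_nth (fps_exp x * gauss_fps) 0"
    by (simp add: gauss_fps_def)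
qed

lemma He_generating_function:
  "(\<lambda>m. He m x * t ^ m / fact m) sums exp (x * t - t\<^sup>2 / 2)"
proof -
  let ?F = "fps_exp x * gauss_fps"
  have R: "fps_conv_radius ?F = \<infinity>"
    using fps_conv_radius_mult[of "fps_exp x" gauss_fps]
    by (simp add: fps_conv_radius_gauss_fps)
  have "(\<lambda>m. fps_nth ?F m * t ^ m) sums eval_fps ?F t"
    by (rule sums_eval_fps) (simp add: R)
  moreover have "eval_fps ?F t = eval_fps (fps_exp x) t * eval_fps gauss_fps t"
    by (rule eval_fps_mult) (simp_all add: fps_conv_radius_gauss_fps)
  moreover have "eval_fps gauss_fps t = exp (- t\<^sup>2 / 2)"
    using gauss_fps_sums[of t] by (simp add: eval_fps_def sums_iff)
  ultimately have "(\<lambda>m. fps_nth ?F m * t ^ m) sums exp (x * t - t\<^sup>2 / 2)"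
    by (simp flip: exp_add)
  then show ?thesis
    by (simp add: He_def He_fps)
qed

end

(*
  The generating function F(t) = (1 - t)^h (1 + (q-1) t)^(N-h) of the Krawtchouk values satisfies
    (1 - t) (1 + (q-1) t) F'(t) = ((q-1) N - q h - (q-1) N t) F(t),
  which is a three-term recurrence for K_n. Put s = sqrt (q-1) and a_n = K_n / (s sqrt N)^n.
  Since q sigma = s, for h = N p + sigma sqrt N x + O(1) the recurrence reads
    (n+2) a_(n+2) = (- x + O(1 / sqrt N)) a_(n+1) - (1 - n / N) a_n,
  uniformly for bounded x. Its limit is the recurrence of (-1)^n He_n(x) / n!, so induction on n
  gives the uniform limit of a_n; the theorem then follows from N^d / binom(N, d) -> d!.
*)

theory Submission
  imports Defs "HOL-Real_Asymp.Real_Asymp"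
begin

section \<open>Krawtchouk values: generating function and recurrence\<close>

lemma fps_nth_one_plus_const_X_power:
  fixes c :: "'a::comm_ring_1"
  shows "fps_nth ((1 + fps_const c * fps_X) ^ m) k = c ^ k * of_nat (m choose k)"
proof (induction m arbitrary: k)
  case 0
  then show ?case by (cases k) auto
next
  case (Suc m)
  have "fps_nth ((1 + fps_const c * fps_X) ^ Suc m) k
      = fps_nth ((1 + fps_const c * fps_X) ^ m) k
        + c * fps_nth (fps_X * (1 + fps_const c * fps_X) ^ m) k"
    by (simp add: distrib_right mult.assoc)
  then show ?case
    by (cases k) (simp_all add: Suc del: power_Suc, simp_all add: algebra_simps)
qed

text \<open>The defining sum is the Cauchy product of the two binomial expansions. Extending its
  range from \<open>min n h\<close> to \<open>n\<close> only adds terms in which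
  \<open>h choose j\<close> vanishes.\<close>

lemma krawtchouk_eq_fps_nth:
  "krawtchouk q n h N
     = fps_nth ((1 + fps_const (-1) * fps_X) ^ h * (1 + fps_const (real q - 1) * fps_X) ^ (N - h)) n"
proof -
  have "krawtchouk q n h N
      = (\<Sum>j = 0..n. (-1) ^ j * (real q - 1) ^ (n - j) * real (h choose j) * real ((N - h) choose (n - j)))"
    unfolding krawtchouk_def by (intro sum.mono_neutral_left) auto
  then show ?thesis
    unfolding fps_mult_nth fps_nth_one_plus_const_X_power by (simp add: mult_ac)
qed

text \<open>The power rule multiplied by \<open>A\<close>, which avoids the exponent
  \<open>n - 1\<close> and covers \<open>n = 0\<close> without a case split.\<close>

lemma fps_mult_deriv_power:
  fixes A :: "'a::comm_ring_1 fps"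
  shows "A * fps_deriv (A ^ n) = of_nat n * fps_deriv A * A ^ n"
  by (induction n) (simp_all add: algebra_simps)

lemma krawtchouk_0: "krawtchouk q 0 h N = 1"
  by (simp add: krawtchouk_def)

text \<open>This is the logarithmic derivative of \<open>A ^ h * B ^ (N - h)\<close>, cleared of
  denominators by the factor \<open>A * B\<close>. The product is expanded in powers of
  \<open>fps_X\<close> so that comparing coefficients yields the recurrence directly.\<close>

lemma krawtchouk_ode:
  fixes q h N :: nat
  assumes "h \<le> N"
  defines "c \<equiv> real q - 1" and "F \<equiv> Abs_fps (\<lambda>n. krawtchouk q n h N)"
  shows "fps_deriv F + fps_const (c - 1) * (fps_X * fps_deriv F) - fps_const c * (fps_X * (fps_X * fps_deriv F))
       = fps_const (c * real N - real q * real h) * F - fps_const (c * real N) * (fps_X * F)"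
proof -
  define A B :: "real fps" where "A = 1 + fps_const (-1) * fps_X" and "B = 1 + fps_const c * fps_X"
  have F: "F = A ^ h * B ^ (N - h)"
    by (simp add: fps_eq_iff F_def A_def B_def c_def krawtchouk_eq_fps_nth)
  have dA: "fps_deriv A = - 1" and dB: "fps_deriv B = fps_const c"
    by (simp_all add: A_def B_def fps_eq_iff)
  have "A * B * fps_deriv F
      = B ^ (N - h) * B * (A * fps_deriv (A ^ h)) + A ^ h * A * (B * fps_deriv (B ^ (N - h)))"
    unfolding F fps_deriv_mult by (simp only: ring_distribs mult_ac add_ac)
  also have "\<dots> = (of_nat (N - h) * fps_const c * A - of_nat h * B) * F"
    unfolding fps_mult_deriv_power dA dB F by (simp add: ring_distribs mult_ac)
  also have "of_nat (N - h) * fps_const c * A - of_nat h * B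
      = fps_const (c * real N - real q * real h) - fps_const (c * real N) * fps_X"
  proof -
    \<comment> \<open>Used with \<open>u = real (N - h)\<close> and \<open>v = real h\<close>. The
      constant term then simplifies by \<open>1 + c = real q\<close>, and the linear one by
      \<open>u + v = real N\<close>.\<close>
    have "fps_const u * fps_const c * A - fps_const v * B
        = fps_const (u * c - v) - fps_const ((u + v) * c) * fps_X" for u v
      by (rule fps_ext) (simp add: A_def B_def ring_distribs mult.assoc)
    moreover have "real (N - h) * c - real h = c * real N - real q * real h"
      using assms(1) by (simp add: c_def of_nat_diff algebra_simps)
    moreover have "(real (N - h) + real h) * c = c * real N"
      using assms(1) by (simp add: of_nat_diff)
    ultimately show ?thesis
      unfolding fps_of_nat[symmetric] by metis
  qed
  finally have *: "A * B * fps_deriv F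
      = (fps_const (c * real N - real q * real h) - fps_const (c * real N) * fps_X) * F" .
  have "A * B = 1 + fps_const (c - 1) * fps_X - fps_const c * (fps_X * fps_X)"
    by (simp add: A_def B_def ring_distribs mult_ac fps_const_sub[symmetric] fps_const_neg[symmetric]
        del: fps_const_sub fps_const_neg)
  with * show ?thesis
    by (simp add: ring_distribs mult.assoc)
qed

lemma krawtchouk_1:
  assumes "h \<le> N"
  shows "krawtchouk q 1 h N = (real q - 1) * real N - real q * real h"
  using arg_cong[OF krawtchouk_ode[OF assms, of q], of "\<lambda>f. fps_nth f 0"]
  by (simp add: krawtchouk_0)

lemma krawtchouk_rec:
  assumes "h \<le> N"
  shows "real (n + 2) * krawtchouk q (n + 2) h N
       = ((real q - 1) * real N - real q * real h - (real q - 2) * real (n + 1)) * krawtchouk q (n + 1) h N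
         - (real q - 1) * (real N - real n) * krawtchouk q n h N"
  using arg_cong[OF krawtchouk_ode[OF assms, of q], of "\<lambda>f. fps_nth f (n + 1)"]
  \<comment> \<open>The term with two factors \<open>fps_X\<close> contributes coefficient
    \<open>n - 1\<close> of the derivative, hence the split on \<open>n\<close>.\<close>
  by (cases n) (simp_all add: algebra_simps numeral_2_eq_2)

section \<open>Hermite polynomials: the matching recurrence\<close>

lemma He_div_fact: "He n x / fact n = fps_nth (fps_exp x * gauss_fps) n"
  by (simp add: He_def He_fps)

lemma He_ode:
  defines "E x \<equiv> Abs_fps (\<lambda>n. He n x / fact n)"
  shows "fps_deriv (E x) = fps_const x * E x - fps_X * E x"
proof -
  have "E x = fps_exp x * gauss_fps"
    by (simp add: fps_eq_iff E_def He_div_fact)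
  then show ?thesis
    by (simp add: fps_deriv_gauss_fps algebra_simps)
qed

lemma He_0: "He 0 x = 1"
  by (simp add: He_def)

lemma He_1: "He 1 x = x"
  using arg_cong[OF He_ode[of x], of "\<lambda>f. fps_nth f 0"] by (simp add: He_0)

text \<open>Coefficient \<open>n + 1\<close> of the differential equation. The factorials stay
  inside because the quotients \<open>He n x / fact n\<close> are, up to sign, the limits of the
  normalized Krawtchouk values.\<close>

lemma He_rec:
  "real (n + 2) * (He (n + 2) x / fact (n + 2)) = x * (He (n + 1) x / fact (n + 1)) - He n x / fact n"
  using arg_cong[OF He_ode[of x], of "\<lambda>f. fps_nth f (n + 1)"]
  by (simp add: numeral_2_eq_2 del: fact_Suc)

section \<open>Tools for uniform limits\<close>

text \<open>Products of uniform limits require bounded limit functions. Each coefficient is a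
  polynomial in \<open>x\<close>, hence continuous on the compact closure of
  \<open>K\<close>.\<close>

lemma bounded_He_image:
  assumes "bounded K"
  shows "bounded ((\<lambda>x. (-1) ^ n * (He n x / fact n)) ` K)"
proof -
  have "continuous_on (closure K) (\<lambda>x. (-1) ^ n * (He n x / fact n))"
    unfolding He_div_fact fps_mult_nth fps_exp_nth by (intro continuous_intros) auto
  moreover have "compact (closure K)"
    using assms by simp
  ultimately have "bounded ((\<lambda>x. (-1) ^ n * (He n x / fact n)) ` closure K)"
    by (intro compact_imp_bounded compact_continuous_image)
  then show ?thesis
    by (rule bounded_subset) (intro image_mono closure_subset)
qed

lemma uniform_limit_bound:
  fixes f :: "'i \<Rightarrow> 'b \<Rightarrow> 'a::real_normed_vector"
  assumes "\<forall>\<^sub>F n in F. \<forall>x\<in>K. norm (f n x - g x) \<le> e n" "(e \<longlongrightarrow> 0) F"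
  shows "uniform_limit K f g F"
proof (rule uniform_limitI)
  fix \<epsilon> :: real
  assume "\<epsilon> > 0"
  with assms(2) have "\<forall>\<^sub>F n in F. e n < \<epsilon>"
    by (rule order_tendstoD)
  with assms(1) show "\<forall>\<^sub>F n in F. \<forall>x\<in>K. dist (f n x) (g x) < \<epsilon>"
    by eventually_elim (force simp: dist_norm)
qed

text \<open>The quotient is \<open>fact d\<close> times the product of the \<open>d\<close> factors
  \<open>N / (N - i)\<close>, each of which tends to 1.\<close>

lemma power_div_binomial_tendsto:
  "(\<lambda>N. real N ^ d / real (N choose d)) \<longlonglongrightarrow> fact d"
proof -
  have "(\<lambda>N. (\<Prod>i<d. real N / (real N - real i)) * fact d) \<longlonglongrightarrow> (\<Prod>i<d. 1) * fact d"
  proof (intro tendsto_mult tendsto_prod tendsto_const)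
    fix i
    show "(\<lambda>N. real N / (real N - real i)) \<longlonglongrightarrow> 1"
      by real_asymp
  qed
  moreover have "\<forall>\<^sub>F N in sequentially.
     (\<Prod>i<d. real N / (real N - real i)) * fact d = real N ^ d / real (N choose d)"
    using eventually_ge_at_top[of d]
  proof eventually_elim
    case (elim N)
    show ?case
      by (simp add: binomial_gbinomial gbinomial_prod_rev prod_dividef lessThan_atLeast0)
  qed
  ultimately show ?thesis
    by (simp add: tendsto_cong)
qed

section \<open>Passing to the limit in the recurrence\<close>

text \<open>The floor enters only through its rounding error, so \<open>h\<close> may be any
  admissible integer within distance 1 of the central value.\<close>

lemma krawtchouk_normalized_uniform_limit:
  fixes q n :: nat and p \<sigma> :: real and K :: "real set" and h :: "nat \<Rightarrow> real \<Rightarrow> nat"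
  assumes q: "q \<ge> 2" and p: "p = (real q - 1) / real q"
    and \<sigma>: "\<sigma>\<^sup>2 = p * (1 - p)" "\<sigma> > 0" and K: "bounded K"
    and h: "\<forall>\<^sub>F N in sequentially. \<forall>x\<in>K. h N x \<le> N \<and>
              \<bar>real (h N x) - (real N * p + \<sigma> * sqrt (real N) * x)\<bar> \<le> 1"
  shows "uniform_limit K
           (\<lambda>N x. krawtchouk q n (h N x) N / (sqrt (real q - 1) * sqrt (real N)) ^ n)
           (\<lambda>x. (-1) ^ n * (He n x / fact n)) sequentially"
proof -
  define s where "s = sqrt (real q - 1)"
  define a where "a n N x = krawtchouk q n (h N x) N / (s * sqrt (real N)) ^ n" for n N x
  define b where "b n x = (-1) ^ n * (He n x / fact n)" for n x
  have s: "s > 0" "s * s = real q - 1"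
    using q by (auto simp: s_def)
  have "(real q * \<sigma>)\<^sup>2 = s\<^sup>2"
    using q unfolding power_mult_distrib \<sigma>(1) p power2_eq_square[of s] s(2)
    by (simp add: field_simps power2_eq_square)
  then have q\<sigma>: "real q * \<sigma> = s"
    using s \<sigma> q by (simp add: power2_eq_iff_nonneg)
  \<comment> \<open>The shift \<open>e\<close> is 0 for \<open>n = 1\<close> and
    \<open>(q - 2) * (n + 1)\<close> in the recurrence. It is independent of \<open>N\<close>, so
    division by \<open>s * sqrt N\<close> makes it vanish.\<close>
  have coeff: "uniform_limit K
      (\<lambda>N x. ((real q - 1) * real N - real q * real (h N x) - e) / (s * sqrt (real N))) (\<lambda>x. - x) sequentially" for e
  proof (rule uniform_limit_bound)
    show "(\<lambda>N. (real q + \<bar>e\<bar>) / (s * sqrt (real N))) \<longlonglongrightarrow> 0"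
      using s(1) by real_asymp
    show "\<forall>\<^sub>F N in sequentially. \<forall>x\<in>K.
        norm (((real q - 1) * real N - real q * real (h N x) - e) / (s * sqrt (real N)) - - x)
        \<le> (real q + \<bar>e\<bar>) / (s * sqrt (real N))"
      using h eventually_gt_at_top[of 0]
    proof eventually_elim
      case (elim N)
      show ?case
      proof
        fix x assume "x \<in> K"
        define \<delta> where "\<delta> = real (h N x) - (real N * p + \<sigma> * sqrt (real N) * x)"
        have "\<bar>\<delta>\<bar> \<le> 1"
          using elim \<open>x \<in> K\<close> by (simp add: \<delta>_def)
        then have "\<bar>real q * \<delta>\<bar> \<le> real q"
          by (simp add: abs_mult mult_left_le)
        then have "\<bar>- (real q * \<delta>) - e\<bar> \<le> real q + \<bar>e\<bar>"
          by linarith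
        moreover have r: "s * sqrt (real N) > 0"
          using s(1) elim by simp
        moreover have "((real q - 1) * real N - real q * real (h N x) - e) / (s * sqrt (real N)) - - x
            = (- (real q * \<delta>) - e) / (s * sqrt (real N))"
        proof -
          \<comment> \<open>Here \<open>q * p = q - 1\<close> matches the terms of order
            \<open>N\<close>, and \<open>q * \<sigma> = s\<close> those of order
            \<open>sqrt N\<close>; only the rounding error \<delta> and \<open>e\<close>
            remain.\<close>
          have "real q * \<delta> = real q * real (h N x) - (real q - 1) * real N - s * sqrt (real N) * x"
            using q unfolding \<delta>_def p q\<sigma>[symmetric] by (simp add: field_simps)
          then have "- (real q * \<delta>) - e
              = ((real q - 1) * real N - real q * real (h N x) - e) + x * (s * sqrt (real N))"
            by (simp add: algebra_simps)
          moreover have "(u + x * v) / v = u / v - - x" if "v > 0" for u v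
            using that by (simp add: add_divide_distrib)
          ultimately show ?thesis
            using r by metis
        qed
        ultimately show "norm (((real q - 1) * real N - real q * real (h N x) - e) / (s * sqrt (real N)) - - x)
            \<le> (real q + \<bar>e\<bar>) / (s * sqrt (real N))"
          by (simp only: real_norm_def abs_divide abs_of_pos divide_right_mono less_imp_le)
      qed
    qed
  qed
  \<comment> \<open>The recurrence has order two, so the induction carries two consecutive
    indices.\<close>
  have "uniform_limit K (a n) (b n) sequentially \<and> uniform_limit K (a (Suc n)) (b (Suc n)) sequentially"
  proof (induction n)
    case 0
    have "a 0 = (\<lambda>N x. 1)" "b 0 = (\<lambda>x. 1)"
      by (simp_all add: fun_eq_iff a_def b_def krawtchouk_0 He_0)
    moreover have "uniform_limit K (a (Suc 0)) (b (Suc 0)) sequentially"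
    proof (rule iffD1[OF uniform_limit_cong coeff[of 0]])
      show "\<forall>\<^sub>F N in sequentially. \<forall>x\<in>K.
          ((real q - 1) * real N - real q * real (h N x) - 0) / (s * sqrt (real N)) = a (Suc 0) N x"
        using h by eventually_elim (use krawtchouk_1 in \<open>simp add: a_def\<close>)
      show "- x = b (Suc 0) x" for x
        using He_1 by (simp add: b_def)
    qed
    ultimately show ?case
      by (auto intro: uniform_limit_const)
  next
    case (Suc n)
    let ?c = "\<lambda>N x. ((real q - 1) * real N - real q * real (h N x) - (real q - 2) * real (n + 1)) / (s * sqrt (real N))"
    have b_rec: "b (n + 2) x = (- x * b (n + 1) x - 1 * b n x) * (1 / real (n + 2))" for x
    proof -
      have "b (n + 2) x = (-1) ^ n * (real (n + 2) * (He (n + 2) x / fact (n + 2))) * (1 / real (n + 2))"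
        unfolding b_def by (simp del: fact_Suc)
      then show ?thesis
        unfolding He_rec by (simp add: b_def algebra_simps del: fact_Suc)
    qed
    have "(\<lambda>N. 1 - real n / real N) \<longlonglongrightarrow> 1"
      by real_asymp
    then have one: "uniform_limit K (\<lambda>N x. 1 - real n / real N) (\<lambda>x. 1) sequentially"
      by (auto simp: uniform_limit_iff tendsto_iff)
    \<comment> \<open>Division of the Krawtchouk recurrence by \<open>(n + 2) * r ^ (n + 2)\<close>,
      where \<open>r = s * sqrt N\<close>, \<open>v = n + 2\<close>, \<open>e = 1 - n / N\<close>
      and \<open>k0\<close>, \<open>k1\<close>, \<open>k2\<close> are consecutive values.\<close>
    have rescale: "(c * (k1 / r ^ (n + 1)) - e * (k0 / r ^ n)) * (1 / v) = k2 / r ^ (n + 2)"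
      if "v * k2 = c * r * k1 - r * r * e * k0" "r > 0" "v > 0" for c e v r k0 k1 k2 :: real
    proof -
      have k2: "k2 = (c * r * k1 - r * r * e * k0) / v"
        using that by (simp add: field_simps)
      show ?thesis
        unfolding k2 using that(2,3) by (simp add: field_simps)
    qed
    have bdd: "bounded (uminus ` K)" "bounded ((\<lambda>x. 1 :: real) ` K)"
      using K by (simp_all add: bounded_subset[of "{1}"] image_subset_iff)
    have bdd_b: "bounded (b n ` K)" for n
      using bounded_He_image[OF K, of n] by (simp add: b_def[abs_def])
    have "uniform_limit K (\<lambda>N x. (?c N x * a (n + 1) N x - (1 - real n / real N) * a n N x) * (1 / real (n + 2)))
        (\<lambda>x. (- x * b (n + 1) x - 1 * b n x) * (1 / real (n + 2))) sequentially"
      using Suc.IH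
      by (intro bounded_linear.uniform_limit[OF bounded_linear_mult_left] uniform_limit_minus
           uniform_lim_mult[OF coeff] uniform_lim_mult[OF one] bdd bdd_b) auto
    moreover have "\<forall>\<^sub>F N in sequentially. \<forall>x\<in>K.
       (?c N x * a (n + 1) N x - (1 - real n / real N) * a n N x) * (1 / real (n + 2)) = a (n + 2) N x"
      using h eventually_gt_at_top[of 0]
    proof eventually_elim
      case (elim N)
      show ?case
      proof
        fix x assume "x \<in> K"
        define r where "r = s * sqrt (real N)"
        have r: "r > 0"
          using elim s by (simp add: r_def)
        have rr: "(real q - 1) * (real N - real n) = r * r * (1 - real n / real N)"
        proof -
          have "r * r = s * s * (sqrt (real N) * sqrt (real N))"
            by (simp only: r_def mult_ac)
          then have "r * r = (real q - 1) * real N"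
            by (simp add: s(2))
          then show ?thesis
            using elim by (simp only:) (simp add: field_simps)
        qed
        have "real (n + 2) * krawtchouk q (n + 2) (h N x) N
            = ?c N x * r * krawtchouk q (n + 1) (h N x) N
              - r * r * (1 - real n / real N) * krawtchouk q n (h N x) N"
          using krawtchouk_rec[of "h N x" N n q] elim \<open>x \<in> K\<close> s(1)
          unfolding rr by (simp add: r_def)
        then show "(?c N x * a (n + 1) N x - (1 - real n / real N) * a n N x) * (1 / real (n + 2)) = a (n + 2) N x"
          unfolding a_def r_def[symmetric] by (intro rescale) (use r in simp_all)
      qed
    qed
    ultimately have "uniform_limit K (a (n + 2)) (b (n + 2)) sequentially"
      unfolding b_rec[symmetric] by (subst (asm) uniform_limit_cong) auto
    with Suc.IH show ?case by simp
  qed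
  then show ?thesis
    by (simp add: a_def[abs_def] b_def[abs_def] s_def)
qed

section \<open>From powers of N to the binomial normalization\<close>

theorem proposition4p5:
  fixes q d :: nat and p \<sigma> :: real and K :: "real set"
  assumes "q \<ge> 2"
    and "p = (real q - 1) / real q"
    and "\<sigma>\<^sup>2 = p * (1 - p)" and "\<sigma> > 0"
    and "compact K"
  shows "uniform_limit K
           (\<lambda>N x. krawtchouk q d (nat \<lfloor>real N * p + \<sigma> * sqrt (real N) * x\<rfloor>) N
                    / sqrt ((real q - 1) ^ d * real (N choose d)))
           (\<lambda>x. (-1) ^ d / sqrt (fact d) * He d x)
           sequentially"
proof -
  let ?h = "\<lambda>N x. nat \<lfloor>real N * p + \<sigma> * sqrt (real N) * x\<rfloor>"
  let ?a = "\<lambda>N x. krawtchouk q d (?h N x) N / (sqrt (real q - 1) * sqrt (real N)) ^ d"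
  let ?b = "\<lambda>x. (-1) ^ d * (He d x / fact d)"
  have p: "0 < p" "p < 1"
    using assms(1,2) by simp_all
  have K: "bounded K"
    using assms(5) by (rule compact_imp_bounded)
  then obtain M where M: "\<And>x. x \<in> K \<Longrightarrow> \<bar>x\<bar> \<le> M"
    by (auto simp: bounded_iff)
  \<comment> \<open>Since \<open>0 < p < 1\<close>, the linear terms dominate \<open>sqrt N\<close>.
    For large \<open>N\<close> the floor is thus nonnegative, so \<open>nat\<close> does not
    truncate, and it is at most \<open>N\<close>, uniformly on \<open>K\<close>.\<close>
  have "\<forall>\<^sub>F N in sequentially. real N * p - \<sigma> * sqrt (real N) * M \<ge> 0"
    using p \<open>\<sigma> > 0\<close> by real_asymp
  moreover have "\<forall>\<^sub>F N in sequentially. real N * p + \<sigma> * sqrt (real N) * M \<le> real N"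
    using p \<open>\<sigma> > 0\<close> by real_asymp
  ultimately have h: "\<forall>\<^sub>F N in sequentially. \<forall>x\<in>K. ?h N x \<le> N \<and>
      \<bar>real (?h N x) - (real N * p + \<sigma> * sqrt (real N) * x)\<bar> \<le> 1"
  proof eventually_elim
    case (elim N)
    show ?case
    proof
      fix x assume "x \<in> K"
      then have "\<bar>\<sigma> * sqrt (real N) * x\<bar> \<le> \<sigma> * sqrt (real N) * M"
        using M \<open>\<sigma> > 0\<close> by (simp add: abs_mult mult_left_mono)
      with elim show "?h N x \<le> N \<and> \<bar>real (?h N x) - (real N * p + \<sigma> * sqrt (real N) * x)\<bar> \<le> 1"
        by linarith
    qed
  qed
  have lim: "uniform_limit K ?a ?b sequentially"
    by (rule krawtchouk_normalized_uniform_limit[OF assms(1-4) K h])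
  have bdd: "bounded (?b ` K)"
    by (rule bounded_He_image[OF K])
  \<comment> \<open>This is the ratio of the two normalizations; it turns the limit factor
    \<open>1 / fact d\<close> into \<open>1 / sqrt (fact d)\<close>.\<close>
  have "(\<lambda>N. sqrt (real N ^ d / real (N choose d))) \<longlonglongrightarrow> sqrt (fact d)"
    by (intro tendsto_intros power_div_binomial_tendsto)
  then have "uniform_limit K (\<lambda>N x. sqrt (real N ^ d / real (N choose d))) (\<lambda>x. sqrt (fact d)) sequentially"
    by (auto simp: uniform_limit_iff tendsto_iff)
  then have "uniform_limit K (\<lambda>N x. ?a N x * sqrt (real N ^ d / real (N choose d)))
      (\<lambda>x. ?b x * sqrt (fact d)) sequentially"
    by (rule uniform_lim_mult[OF lim _ bdd]) (rule bounded_subset[of "{sqrt (fact d)}"], auto)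
  moreover have "\<forall>\<^sub>F N in sequentially. \<forall>x\<in>K. ?a N x * sqrt (real N ^ d / real (N choose d))
      = krawtchouk q d (?h N x) N / sqrt ((real q - 1) ^ d * real (N choose d))"
    \<comment> \<open>With \<open>N > 0\<close> the powers of \<open>sqrt N\<close> cancel. If
      \<open>N < d\<close>, both sides are 0, as division by zero gives 0.\<close>
    using eventually_gt_at_top[of 0]
    by eventually_elim (simp add: real_sqrt_mult real_sqrt_divide real_sqrt_power power_mult_distrib)
  moreover have "?b x * sqrt (fact d) = (-1) ^ d / sqrt (fact d) * He d x" for x
    by (simp add: field_simps)
  ultimately show ?thesis
    by (subst (asm) uniform_limit_cong) auto
qed

end
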